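(* Let $\lambda,\nu>0$ and let $(X_t)_{t\ge0}$ be the $M/M/1$ queueing process on $\mathbb{N}$, i.e. the birth–death process with generator $$\mathcal{L}f(x)=\lambda(f(x+1)-f(x))+\nu 1_{\{x\ne0\}}(f(x-1)-f(x)),\qquad x\in\mathbb{N}.$$ Let $0=t_0<t_1<\cdots<t_n=T$, consider the sample $X^n=(X_{t_1},\dots,X_{t_n})$, and let $f:\mathbb{N}^n\to\mathbb{R}$ be $\ell^1$-Lipschitz. Then for any $x\in\mathbb{N}$ and any $y>0$, $$\mathbb{P}_x\big(f(X^n)-\mathbb{E}_x[f(X^n)]\ge y\big)\le\exp\left(-\frac{y}{2n\|f\|_{\mathrm{Lip}(n)}}\log\left(1+\frac{y}{Tn(\lambda+\nu)\|f\|_{\mathrm{Lip}(n)}}\right)\right).$$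
   Context: Here $\mathbb{N}=\{0,1,2,\dots\}$, and $\mathbb{P}_x,\mathbb{E}_x$ refer to the process started at $X_0=x$. A function $f:\mathbb{N}^n\to\mathbb{R}$ is $\ell^1$-Lipschitz if $\|f\|_{\mathrm{Lip}(n)}:=\sup_{x\ne y}|f(x)-f(y)|/\|x-y\|_1<+\infty$, where $\|z\|_1=\sum_{i=1}^n|z_i|$. *)

theory Defs
  imports "HOL-Probability.Probability"
begin

section \<open>Continuous-time Markov chains on the natural numbers\<close>

text \<open>
  Honest transition functions \<open>P t x = p_t(x, _)\<close>; only times \<open>t \<ge> 0\<close> are meaningful.
\<close>

definition transition_semigroup :: "(real \<Rightarrow> nat \<Rightarrow> nat pmf) \<Rightarrow> bool" where
  "transition_semigroup P \<longleftrightarrow>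
     (\<forall>x. P 0 x = return_pmf x) \<and>
     (\<forall>s\<ge>0. \<forall>t\<ge>0. \<forall>x. P (s + t) x = bind_pmf (P s x) (P t))"

text \<open>
  Only bounded test functions and pointwise convergence are required. For a generator with
  bounded jump rates, such as the one below, this already determines the semigroup, and
  the convergence is then automatically uniform in \<open>x\<close>.
\<close>

definition has_generator ::
    "(real \<Rightarrow> nat \<Rightarrow> nat pmf) \<Rightarrow> ((nat \<Rightarrow> real) \<Rightarrow> nat \<Rightarrow> real) \<Rightarrow> bool" where
  "has_generator P L \<longleftrightarrow>
     (\<forall>g x. bounded (range g) \<longrightarrow>
       ((\<lambda>t. (measure_pmf.expectation (P t x) g - g x) / t) \<longlongrightarrow> L g x) (at_right 0))"

text \<open>
  The Markov property is the elementary one for a countable state space: conditionally on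
  finitely many past values (an event of positive probability) the law of a later value is
  given by the transition function applied to the last observed value. No path regularity
  is imposed, i.e. the process is specified through its finite-dimensional distributions.
\<close>

definition markov_chain_from ::
    "(real \<Rightarrow> nat \<Rightarrow> nat pmf) \<Rightarrow> nat \<Rightarrow> 'a measure \<Rightarrow> (real \<Rightarrow> 'a \<Rightarrow> nat) \<Rightarrow> bool" where
  "markov_chain_from P x M X \<longleftrightarrow>
     prob_space M \<and>
     (\<forall>t\<ge>0. X t \<in> measurable M (count_space UNIV)) \<and>
     (AE \<omega> in M. X 0 \<omega> = x) \<and>
     (\<forall>m (s :: nat \<Rightarrow> real) (z :: nat \<Rightarrow> nat).
        0 \<le> s 0 \<longrightarrow> (\<forall>k\<le>m. s k < s (Suc k)) \<longrightarrow>
        measure M {\<omega> \<in> space M. \<forall>k\<le>m. X (s k) \<omega> = z k} > 0 \<longrightarrow>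
        cond_prob M (\<lambda>\<omega>. X (s (Suc m)) \<omega> = z (Suc m)) (\<lambda>\<omega>. \<forall>k\<le>m. X (s k) \<omega> = z k)
          = pmf (P (s (Suc m) - s m) (z m)) (z (Suc m)))"


section \<open>The M/M/1 queueing process\<close>

definition mm1_generator :: "real \<Rightarrow> real \<Rightarrow> (nat \<Rightarrow> real) \<Rightarrow> nat \<Rightarrow> real" where
  "mm1_generator lam \<nu> g x =
     lam * (g (x + 1) - g x) + \<nu> * of_bool (x \<noteq> 0) * (g (x - 1) - g x)"

definition mm1_process_from ::
    "real \<Rightarrow> real \<Rightarrow> nat \<Rightarrow> 'a measure \<Rightarrow> (real \<Rightarrow> 'a \<Rightarrow> nat) \<Rightarrow> bool" where
  "mm1_process_from lam \<nu> x M X \<longleftrightarrow>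
     (\<exists>P. transition_semigroup P \<and> has_generator P (mm1_generator lam \<nu>) \<and>
          markov_chain_from P x M X)"


section \<open>Lipschitz functions for the \<open>\<ell>\<^sup>1\<close>-distance\<close>

text \<open>
  Elements of \<open>\<nat>\<^sup>n\<close> are lists of length \<open>n\<close>; values of functions on lists of any other
  length are irrelevant.
\<close>

definition l1_dist :: "nat list \<Rightarrow> nat list \<Rightarrow> real" where
  "l1_dist xs ys = (\<Sum>i<length xs. \<bar>real (xs ! i) - real (ys ! i)\<bar>)"

definition lip_quotients :: "nat \<Rightarrow> (nat list \<Rightarrow> real) \<Rightarrow> real set" where
  "lip_quotients n f =
     {\<bar>f xs - f ys\<bar> / l1_dist xs ys | xs ys. length xs = n \<and> length ys = n \<and> xs \<noteq> ys}"

definition l1_lipschitz :: "nat \<Rightarrow> (nat list \<Rightarrow> real) \<Rightarrow> bool" where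
  "l1_lipschitz n f \<longleftrightarrow> bdd_above (lip_quotients n f)"

definition lip_norm :: "nat \<Rightarrow> (nat list \<Rightarrow> real) \<Rightarrow> real" where
  "lip_norm n f = Sup (lip_quotients n f)"

definition sample :: "(real \<Rightarrow> 'a \<Rightarrow> nat) \<Rightarrow> (nat \<Rightarrow> real) \<Rightarrow> nat \<Rightarrow> 'a \<Rightarrow> nat list" where
  "sample X t n \<omega> = map (\<lambda>i. X (t i) \<omega>) [1..<n + 1]"

end

theory Submission
  imports Defs
begin

text \<open>
  The mean of \<open>exp (\<theta> * (g (X\<^sub>t) - P\<^sub>t g x))\<close> is at most \<open>exp (t * (lam + \<nu>) * (exp (\<theta> * C) - \<theta> * C - 1))\<close>
  for every bounded \<open>C\<close>-Lipschitz \<open>g\<close>, and \<open>P\<^sub>t g\<close> is again \<open>C\<close>-Lipschitz. Both facts hold exactly, without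
  error terms, for the Euler operator \<open>I + h * L\<close>, hence for its powers. As the jump rates are bounded,
  \<open>P\<^sub>h\<close> and \<open>I + h * L\<close> differ by \<open>O (h\<^sup>2)\<close> uniformly in the state, so \<open>P\<^sub>t\<close> is the limit of
  \<open>(I + (t / m) * L) ^ m\<close> and inherits them.

  Integrating out \<open>X\<close> at the sampling times from the last one backwards, the Lipschitz constant in the
  last remaining coordinate grows by \<open>K\<close>, the Lipschitz norm of \<open>f\<close>, at each step and so never exceeds
  \<open>n * K\<close>. The one-step bounds multiply to a bound on the exponential moments of bounded truncations
  of \<open>f\<close>, and Chernoff's bound with \<open>\<theta> * n * K = ln (1 + y / (T * n * (lam + \<nu>) * K))\<close> gives the claim.
\<close>

section \<open>One-sided derivatives and expectations under discrete laws\<close>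

text \<open>A generator provides right derivatives only, so the mean value theorem is replaced by a
  last-point argument. The last point at which \<open>\<phi>\<close> lies on or below the line of
  slope \<open>B + c\<close> must be \<open>b\<close>: at an earlier point the right derivative,
  being below the slope, carries the inequality further.\<close>

lemma right_derivative_bound:
  fixes \<phi> D :: "real \<Rightarrow> real"
  assumes "a \<le> b" and cont: "continuous_on {a..b} \<phi>"
    and deriv: "\<And>s. a \<le> s \<Longrightarrow> s < b \<Longrightarrow> ((\<lambda>h. (\<phi> (s + h) - \<phi> s) / h) \<longlongrightarrow> D s) (at_right 0)"
    and bound: "\<And>s. a \<le> s \<Longrightarrow> s < b \<Longrightarrow> D s \<le> B"
  shows "\<phi> b - \<phi> a \<le> B * (b - a)"
proof (rule field_le_epsilon)
  fix e :: real assume "e > 0"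
  \<comment> \<open>The slack puts the slope strictly above \<open>D\<close>, at a total cost of at
    most \<open>e\<close>; the \<open>+ 1\<close> keeps \<open>c\<close> positive when
    \<open>a = b\<close>.\<close>
  define c where "c = e / (b - a + 1)"
  have "c > 0" using \<open>e > 0\<close> \<open>a \<le> b\<close> by (simp add: c_def)
  define \<psi> where "\<psi> s = \<phi> s - \<phi> a - (B + c) * (s - a)" for s
  define Z where "Z = {s \<in> {a..b}. \<psi> s \<le> 0}"
  have "continuous_on {a..b} \<psi>"
    unfolding \<psi>_def by (intro continuous_intros cont)
  then have "closed Z"
    unfolding Z_def by (intro continuous_on_closed_Collect_le) auto
  moreover have "a \<in> Z" using \<open>a \<le> b\<close> by (simp add: Z_def \<psi>_def)
  moreover have bdd: "bdd_above Z" by (auto simp: Z_def intro!: bdd_aboveI[of _ b])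
  ultimately have tau: "Sup Z \<in> Z" using closed_contains_Sup by blast
  have "\<psi> b \<le> 0"
  proof (rule ccontr)
    assume pos: "\<not> \<psi> b \<le> 0"
    define \<tau> where "\<tau> = Sup Z"
    have \<tau>: "a \<le> \<tau>" "\<tau> \<le> b" "\<psi> \<tau> \<le> 0" using tau by (auto simp: \<tau>_def Z_def)
    with pos have "\<tau> < b" by (cases "\<tau> = b") auto
    have "D \<tau> < B + c" using bound[OF \<tau>(1) \<open>\<tau> < b\<close>] \<open>c > 0\<close> by simp
    then have "\<forall>\<^sub>F h in at_right 0. (\<phi> (\<tau> + h) - \<phi> \<tau>) / h < B + c"
      using deriv[OF \<tau>(1) \<open>\<tau> < b\<close>] order_tendstoD(2) by blast
    then obtain d where d: "d > 0" "\<And>h. 0 < h \<Longrightarrow> h < d \<Longrightarrow> (\<phi> (\<tau> + h) - \<phi> \<tau>) / h < B + c"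
      by (auto simp: eventually_at_right_field)
    define h where "h = min (d / 2) (b - \<tau>)"
    have h: "0 < h" "h < d" "\<tau> + h \<le> b" using d(1) \<open>\<tau> < b\<close> by (auto simp: h_def)
    have "\<phi> (\<tau> + h) - \<phi> \<tau> < (B + c) * h"
      using d(2)[OF h(1,2)] h(1) by (simp add: divide_simps)
    then have "\<psi> (\<tau> + h) \<le> 0" using \<tau>(3) by (simp add: \<psi>_def algebra_simps)
    then have "\<tau> + h \<in> Z" using h \<tau> by (simp add: Z_def)
    then have "\<tau> + h \<le> \<tau>" unfolding \<tau>_def by (rule cSup_upper[OF _ bdd])
    with h(1) show False by simp
  qed
  moreover have "c * (b - a) \<le> e"
    using \<open>e > 0\<close> \<open>a \<le> b\<close> by (simp add: c_def divide_simps mult_left_mono)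
  ultimately show "\<phi> b - \<phi> a \<le> B * (b - a) + e" by (simp add: \<psi>_def algebra_simps)
qed

lemma integrable_pmf_bounded:
  fixes g :: "'a \<Rightarrow> real"
  assumes "\<And>z. \<bar>g z\<bar> \<le> B"
  shows "integrable (measure_pmf p) g"
  by (rule measure_pmf.integrable_const_bound[where B = B]) (use assms in auto)

lemma abs_expectation_pmf_le:
  fixes g :: "'a \<Rightarrow> real"
  assumes "\<And>z. \<bar>g z\<bar> \<le> B"
  shows "\<bar>measure_pmf.expectation p g\<bar> \<le> B"
proof -
  have "integrable (measure_pmf p) g" by (rule integrable_pmf_bounded[OF assms])
  then have "measure_pmf.expectation p g \<le> B" "- measure_pmf.expectation p g \<le> B"
    using assms by (auto simp flip: Bochner_Integration.integral_minus simp: abs_le_iff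
        intro!: measure_pmf.integral_le_const)
  then show ?thesis by simp
qed

lemma expectation_bind_pmf:
  fixes g :: "'b \<Rightarrow> real"
  assumes "\<And>z. \<bar>g z\<bar> \<le> B"
  shows "measure_pmf.expectation (bind_pmf p k) g
           = measure_pmf.expectation p (\<lambda>z. measure_pmf.expectation (k z) g)"
  unfolding measure_pmf_bind
  by (rule integral_bind[where K = "count_space UNIV" and B = B and B' = 1])
     (use assms in \<open>auto simp: measure_pmf_in_subprob_algebra measure_pmf.emeasure_space_le_1\<close>)

text \<open>The extended list determines both its parts, so only the term at \<open>ys\<close>
  contributes.\<close>

lemma pmf_bind_append:
  "pmf (bind_pmf p (\<lambda>xs. map_pmf (\<lambda>z. xs @ [z]) (k xs))) (ys @ [w]) = pmf p ys * pmf (k ys) w"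
proof -
  have "pmf (map_pmf (\<lambda>z. xs @ [z]) (k xs)) (ys @ [w]) = indicator {ys} xs * pmf (k ys) w" for xs
  proof (cases "xs = ys")
    case True
    have "inj (\<lambda>z. ys @ [z])" by (simp add: inj_def)
    then show ?thesis using True pmf_map_inj'[of "\<lambda>z. ys @ [z]" "k ys" w] by simp
  next
    case False
    then show ?thesis by (auto intro!: pmf_map_outside)
  qed
  then show ?thesis by (simp add: pmf_bind measure_pmf_single)
qed

section \<open>Elementary inequalities for the exponent\<close>

text \<open>This is the logarithmic moment generating function of a centred Poisson variable of mean
  one.\<close>

definition compensator :: "real \<Rightarrow> real" where
  "compensator u = exp u - u - 1"

text \<open>The function increases on the nonnegative half-line, and passing from \<open>d\<close>
  to \<open>\<bar>d\<bar>\<close> amounts to \<open>2 * s \<le> exp s - exp (- s)\<close> for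
  \<open>s \<ge> 0\<close>. Upward and downward jumps thereby share one bound.\<close>

lemma compensator_mono_abs:
  assumes "\<bar>d\<bar> \<le> u"
  shows "compensator d \<le> compensator u"
proof -
  have mono: "compensator a \<le> compensator b" if "0 \<le> a" "a \<le> b" for a b
    by (rule DERIV_nonneg_imp_nondecreasing[OF that(2)])
       (use that in \<open>auto simp: compensator_def intro!: derivative_eq_intros\<close>)
  have "exp (- s) - exp s + 2 * s \<le> exp (- 0) - exp 0 + 2 * 0" if "0 \<le> s" for s :: real
  proof (rule DERIV_nonpos_imp_nonincreasing[OF that])
    fix r :: real assume "0 \<le> r"
    have "((\<lambda>s. exp (- s) - exp s + 2 * s) has_real_derivative 2 - (exp r + exp (- r))) (at r)"
      by (auto intro!: derivative_eq_intros)
    moreover have "2 - (exp r + exp (- r)) \<le> 0"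
    proof -
      have "0 \<le> (exp (r/2) - exp (- (r/2)))\<^sup>2" by simp
      also have "\<dots> = exp r + exp (- r) - 2"
        by (simp add: power2_diff flip: exp_double exp_add)
      finally show ?thesis by simp
    qed
    ultimately show "\<exists>y. ((\<lambda>s. exp (- s) - exp s + 2 * s) has_real_derivative y) (at r) \<and> y \<le> 0"
      by blast
  qed
  from this[of "- d"] have "compensator d \<le> compensator \<bar>d\<bar>"
    by (cases "d \<ge> 0") (auto simp: compensator_def)
  also have "\<dots> \<le> compensator u" using assms by (intro mono) auto
  finally show ?thesis .
qed

text \<open>Equivalently, Bennett's function \<open>(1 + u) * ln (1 + u) - u\<close> is at least
  \<open>u / 2 * ln (1 + u)\<close>. The two sides agree at 0, and the difference is nondecreasing
  by \<open>ln v \<le> v - 1\<close> at \<open>v = 1 / (1 + s)\<close>.\<close>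

lemma ln_one_plus_lower_bound:
  fixes u :: real
  assumes "0 \<le> u"
  shows "2 * u \<le> (2 + u) * ln (1 + u)"
proof -
  have "(2 + 0) * ln (1 + 0) - 2 * 0 \<le> (2 + u) * ln (1 + u) - 2 * u"
  proof (rule DERIV_nonneg_imp_nondecreasing[OF assms])
    fix s :: real assume "0 \<le> s"
    have "((\<lambda>u. (2 + u) * ln (1 + u) - 2 * u) has_real_derivative ln (1 + s) + (2 + s) / (1 + s) - 2) (at s)"
      using \<open>0 \<le> s\<close> by (auto intro!: derivative_eq_intros)
    moreover have "ln (1 / (1 + s)) \<le> 1 / (1 + s) - 1"
      using \<open>0 \<le> s\<close> by (intro ln_le_minus_one) auto
    then have "0 \<le> ln (1 + s) + (2 + s) / (1 + s) - 2"
      using \<open>0 \<le> s\<close> by (simp add: ln_div field_simps)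
    ultimately show "\<exists>y. ((\<lambda>u. (2 + u) * ln (1 + u) - 2 * u) has_real_derivative y) (at s) \<and> 0 \<le> y"
      by blast
  qed
  then show ?thesis by simp
qed

section \<open>Lipschitz functions of one state, transition operators and their Euler
  approximation\<close>

definition lip :: "real \<Rightarrow> (nat \<Rightarrow> real) \<Rightarrow> bool" where
  "lip C g \<longleftrightarrow> (\<forall>a b. \<bar>g a - g b\<bar> \<le> C * \<bar>real a - real b\<bar>)"

lemma lip_mono: "lip C g \<Longrightarrow> C \<le> C' \<Longrightarrow> lip C' g"
  unfolding lip_def by (meson abs_ge_zero mult_right_mono order_trans)

lemma lip_neighbours:
  assumes "lip C g"
  shows "\<bar>g (Suc x) - g x\<bar> \<le> C" "\<bar>g (x - 1) - g x\<bar> \<le> C"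
proof -
  \<comment> \<open>At \<open>x = 0\<close> truncated subtraction gives \<open>x - 1 = x\<close>,
    and the second bound reads \<open>0 \<le> C\<close>.\<close>
  have "C \<ge> 0" using assms[unfolded lip_def, rule_format, of 1 0] by simp
  show "\<bar>g (Suc x) - g x\<bar> \<le> C" using assms[unfolded lip_def, rule_format, of "Suc x" x] by simp
  show "\<bar>g (x - 1) - g x\<bar> \<le> C" using assms[unfolded lip_def, rule_format, of "x - 1" x] \<open>C \<ge> 0\<close>
    by (cases x) auto
qed

locale mm1_semigroup =
  fixes lam \<nu> :: real and P :: "real \<Rightarrow> nat \<Rightarrow> nat pmf"
  assumes lam_pos: "lam > 0" and nu_pos: "\<nu> > 0"
    and semigroup: "transition_semigroup P"
    and generator: "has_generator P (mm1_generator lam \<nu>)"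
begin

abbreviation L :: "(nat \<Rightarrow> real) \<Rightarrow> nat \<Rightarrow> real" where
  "L \<equiv> mm1_generator lam \<nu>"

definition T :: "real \<Rightarrow> (nat \<Rightarrow> real) \<Rightarrow> nat \<Rightarrow> real" where
  "T t g x = measure_pmf.expectation (P t x) g"

definition euler :: "real \<Rightarrow> (nat \<Rightarrow> real) \<Rightarrow> nat \<Rightarrow> real" where
  "euler h g x = g x + h * L g x"

text \<open>At \<open>x = 0\<close> truncated subtraction makes the downward difference vanish, so
  one formula covers the boundary as well.\<close>

lemma generator_eq: "L g x = lam * (g (Suc x) - g x) + \<nu> * (g (x - 1) - g x)"
  by (cases x) (auto simp: mm1_generator_def)

lemma T_0 [simp]: "T 0 g = g"
  using semigroup by (auto simp: transition_semigroup_def T_def)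

lemma T_add:
  assumes "0 \<le> s" "0 \<le> t" "\<And>z. \<bar>g z\<bar> \<le> B"
  shows "T (s + t) g = T s (T t g)"
  using semigroup assms
  by (auto simp: transition_semigroup_def T_def[abs_def] expectation_bind_pmf[OF assms(3)])

lemma abs_T_le:
  assumes "\<And>z. \<bar>g z\<bar> \<le> B"
  shows "\<bar>T t g x\<bar> \<le> B"
  unfolding T_def by (rule abs_expectation_pmf_le[OF assms])

lemma T_diff:
  assumes "\<And>z. \<bar>f z\<bar> \<le> A" "\<And>z. \<bar>g z\<bar> \<le> B"
  shows "T t (\<lambda>z. f z - g z) x = T t f x - T t g x"
  unfolding T_def
  by (intro Bochner_Integration.integral_diff integrable_pmf_bounded[OF assms(1)]
      integrable_pmf_bounded[OF assms(2)])

lemma abs_generator_le: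
  assumes "\<And>z. \<bar>g z\<bar> \<le> B"
  shows "\<bar>L g x\<bar> \<le> 2 * (lam + \<nu>) * B"
proof -
  have "\<bar>g y - g x\<bar> \<le> 2 * B" for y using assms[of y] assms[of x] by linarith
  then have "\<bar>lam * (g (Suc x) - g x)\<bar> \<le> lam * (2 * B)" "\<bar>\<nu> * (g (x - 1) - g x)\<bar> \<le> \<nu> * (2 * B)"
    using lam_pos nu_pos by (auto simp: abs_mult)
  then show ?thesis unfolding generator_eq by (simp add: algebra_simps)
qed

lemma generator_diff: "L (\<lambda>z. f z - g z) x = L f x - L g x"
  by (simp add: generator_eq algebra_simps)

lemma generator_tendsto:
  assumes "\<And>z. \<bar>g z\<bar> \<le> B"
  shows "((\<lambda>h. (T h g x - g x) / h) \<longlongrightarrow> L g x) (at_right 0)"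
proof -
  have "bounded (range g)" using assms by (auto simp: bounded_iff)
  then show ?thesis using generator by (simp add: has_generator_def T_def)
qed

text \<open>The difference \<open>g z - g x\<close> vanishes at \<open>z = x\<close> and is at most
  \<open>2 * B\<close> elsewhere. Since \<open>g\<close> enters only through \<open>B\<close>, the
  estimate is uniform over all \<open>T u g\<close>.\<close>

lemma T_near:
  assumes "\<And>z. \<bar>g z\<bar> \<le> B"
  shows "\<bar>T h g x - g x\<bar> \<le> 2 * B * (1 - pmf (P h x) x)"
proof -
  have B: "\<bar>g z - g x\<bar> \<le> 2 * B" for z using assms[of z] assms[of x] by linarith
  let ?r = "\<lambda>z. 2 * B * (1 - indicator {x} z)"
  have I: "integrable (measure_pmf (P h x)) (\<lambda>z. g z - g x)"
    by (rule integrable_pmf_bounded[OF B])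
  have "\<bar>?r z\<bar> \<le> 2 * B" for z using B[of x] by (auto simp: indicator_def)
  then have I': "integrable (measure_pmf (P h x)) ?r" by (rule integrable_pmf_bounded)
  have "T h g x - g x = measure_pmf.expectation (P h x) (\<lambda>z. g z - g x)"
    unfolding T_def using integrable_pmf_bounded[of g B, OF assms] by simp
  also have "\<bar>\<dots>\<bar> \<le> measure_pmf.expectation (P h x) ?r"
    by (intro order_trans[OF integral_abs_bound] integral_mono integrable_abs I I')
       (use B in \<open>auto simp: indicator_def\<close>)
  also have "\<dots> = 2 * B * (1 - pmf (P h x) x)"
    by (subst integral_mult_right_zero, subst Bochner_Integration.integral_diff)
       (auto simp: measure_pmf_single intro!: integrable_pmf_bounded[where B = 1])
  finally show ?thesis .
qed

text \<open>The difference quotient of the indicator of \<open>x\<close> converges, so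
  \<open>h\<close> times it tends to 0.\<close>

lemma holding_tendsto: "((\<lambda>h. 1 - pmf (P h x) x) \<longlongrightarrow> 0) (at_right 0)"
proof -
  let ?g = "indicator {x} :: nat \<Rightarrow> real"
  have "((\<lambda>h. - (h * ((T h ?g x - ?g x) / h))) \<longlongrightarrow> - (0 * L ?g x)) (at_right 0)"
    by (intro tendsto_intros generator_tendsto[where B = 1]) (auto simp: indicator_def)
  moreover have "\<forall>\<^sub>F h in at_right 0. - (h * ((T h ?g x - ?g x) / h)) = 1 - pmf (P h x) x"
    unfolding eventually_at_right_field
    by (intro exI[of _ 1]) (auto simp: T_def measure_pmf_single)
  ultimately have "((\<lambda>h. 1 - pmf (P h x) x) \<longlongrightarrow> - (0 * L ?g x)) (at_right 0)"
    by (rule Lim_transform_eventually)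
  then show ?thesis by simp
qed

text \<open>Since \<open>T (u + h) g = T h (T u g)\<close> and \<open>T_near\<close> is uniform in
  \<open>u\<close>, the behaviour of the holding probability near time 0 gives continuity from both
  sides.\<close>

lemma T_continuous:
  assumes "\<And>z. \<bar>g z\<bar> \<le> B"
  shows "continuous_on {0..b} (\<lambda>s. T s g x)"
  unfolding continuous_on_iff
proof (intro ballI allI impI)
  fix s e :: real assume s: "s \<in> {0..b}" and "e > 0"
  have "B \<ge> 0" using assms[of 0] by linarith
  then have "e / (2 * B + 1) > 0" using \<open>e > 0\<close> by simp
  then have "\<forall>\<^sub>F h in at_right 0. 1 - pmf (P h x) x < e / (2 * B + 1)"
    using holding_tendsto order_tendstoD(2) by blast
  then obtain d where d: "d > 0" "\<And>h. 0 < h \<Longrightarrow> h < d \<Longrightarrow> 1 - pmf (P h x) x < e / (2 * B + 1)"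
    by (auto simp: eventually_at_right_field)
  have step: "\<bar>T (u + h) g x - T u g x\<bar> < e" if "0 \<le> u" "0 < h" "h < d" for u h
  proof -
    have "\<bar>T (u + h) g x - T u g x\<bar> = \<bar>T h (T u g) x - T u g x\<bar>"
      using T_add[of h u g B] assms that by (simp add: add.commute)
    also have "\<dots> \<le> 2 * B * (1 - pmf (P h x) x)"
      by (intro T_near abs_T_le assms)
    also have "\<dots> \<le> 2 * B * (e / (2 * B + 1))"
      using d(2)[OF that(2,3)] \<open>B \<ge> 0\<close> by (intro mult_left_mono) auto
    also have "\<dots> < e" using \<open>B \<ge> 0\<close> \<open>e > 0\<close> by (simp add: field_simps)
    finally show ?thesis .
  qed
  show "\<exists>d>0. \<forall>s'\<in>{0..b}. dist s' s < d \<longrightarrow> dist (T s' g x) (T s g x) < e"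
  proof (intro exI[of _ d] conjI ballI impI d(1))
    fix s' assume s': "s' \<in> {0..b}" "dist s' s < d"
    consider "s' = s" | "s' > s" | "s' < s" by linarith
    then show "dist (T s' g x) (T s g x) < e"
    proof cases
      case 1 then show ?thesis using \<open>e > 0\<close> by simp
    next
      case 2 then show ?thesis using step[of s "s' - s"] s s' by (simp add: dist_real_def)
    next
      case 3 then show ?thesis using step[of s' "s - s'"] s s'
        by (simp add: dist_real_def abs_minus_commute)
    qed
  qed
qed

lemma T_right_derivative:
  assumes "\<And>z. \<bar>g z\<bar> \<le> B" "0 \<le> s"
  shows "((\<lambda>h. (T (s + h) g x - T s g x) / h) \<longlongrightarrow> L (T s g) x) (at_right 0)"
proof -
  have "((\<lambda>h. (T h (T s g) x - T s g x) / h) \<longlongrightarrow> L (T s g) x) (at_right 0)"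
    by (intro generator_tendsto[where B = B] abs_T_le assms)
  moreover have "\<forall>\<^sub>F h in at_right 0. (T h (T s g) x - T s g x) / h = (T (s + h) g x - T s g x) / h"
    unfolding eventually_at_right_field
    using T_add[where g = g, OF _ assms(2) assms(1)] by (intro exI[of _ 1]) (auto simp: add.commute)
  ultimately show ?thesis by (rule Lim_transform_eventually)
qed

text \<open>The right derivative \<open>L (T r g) x\<close> is bounded uniformly in
  \<open>r\<close>, because \<open>T r\<close> preserves the bound \<open>B\<close> and the jump
  rates are bounded.\<close>

lemma T_lipschitz_in_time:
  assumes "\<And>z. \<bar>g z\<bar> \<le> B" "0 \<le> s"
  shows "\<bar>T s g x - g x\<bar> \<le> 2 * (lam + \<nu>) * B * s"
proof -
  have le: "T s f x - f x \<le> 2 * (lam + \<nu>) * B * s" if f: "\<And>z. \<bar>f z\<bar> \<le> B" for f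
  proof -
    have "T s f x - T 0 f x \<le> 2 * (lam + \<nu>) * B * (s - 0)"
    proof (rule right_derivative_bound[OF assms(2) T_continuous[where g = f, OF f]])
      fix r :: real assume "0 \<le> r"
      then show "((\<lambda>h. (T (r + h) f x - T r f x) / h) \<longlongrightarrow> L (T r f) x) (at_right 0)"
        by (intro T_right_derivative[where g = f, OF f])
      have "\<bar>L (T r f) x\<bar> \<le> 2 * (lam + \<nu>) * B" by (intro abs_generator_le abs_T_le f)
      then show "L (T r f) x \<le> 2 * (lam + \<nu>) * B" by simp
    qed
    then show ?thesis by simp
  qed
  have "T s (\<lambda>z. - g z) x = - T s g x" by (simp add: T_def)
  then show ?thesis using le[of g] le[of "\<lambda>z. - g z"] assms(1) by (simp add: abs_le_iff)
qed

text \<open>The right derivative of \<open>T s g x - s * L g x\<close> is \<open>L\<close> applied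
  to \<open>T s g - g\<close>. That function is of order \<open>h\<close> on \<open>[0, h]\<close>,
  and \<open>L\<close> only multiplies its bound by \<open>2 * (lam + \<nu>)\<close>, so the
  increment is of order \<open>h^2\<close>.\<close>

lemma T_minus_euler:
  assumes "\<And>z. \<bar>g z\<bar> \<le> B" "0 \<le> h"
  shows "\<bar>T h g x - euler h g x\<bar> \<le> 4 * (lam + \<nu>)\<^sup>2 * B * h\<^sup>2"
proof -
  let ?q = "lam + \<nu>"
  have "B \<ge> 0" using assms(1)[of 0] by linarith
  have le: "T h f x - euler h f x \<le> 4 * ?q\<^sup>2 * B * h\<^sup>2" if f: "\<And>z. \<bar>f z\<bar> \<le> B" for f
  proof -
    have "(T h f x - h * L f x) - (T 0 f x - 0 * L f x) \<le> 4 * ?q\<^sup>2 * B * h * (h - 0)"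
    proof (rule right_derivative_bound[OF assms(2)])
      show "continuous_on {0..h} (\<lambda>s. T s f x - s * L f x)"
        by (intro continuous_intros T_continuous[where g = f, OF f])
    next
      fix r :: real assume r: "0 \<le> r" "r < h"
      have "((\<lambda>s. (T (r + s) f x - T r f x) / s - L f x) \<longlongrightarrow> L (T r f) x - L f x) (at_right 0)"
        by (intro tendsto_intros T_right_derivative[where g = f, OF f] r)
      moreover have "\<forall>\<^sub>F s in at_right 0. (T (r + s) f x - T r f x) / s - L f x
          = (T (r + s) f x - (r + s) * L f x - (T r f x - r * L f x)) / s"
        unfolding eventually_at_right_field
        by (intro exI[of _ 1]) (auto simp: field_simps)
      ultimately show "((\<lambda>s. (T (r + s) f x - (r + s) * L f x - (T r f x - r * L f x)) / s)
          \<longlongrightarrow> L (T r f) x - L f x) (at_right 0)"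
        by (rule Lim_transform_eventually)
      have "\<bar>T r f z - f z\<bar> \<le> 2 * ?q * B * h" for z
      proof -
        have "\<bar>T r f z - f z\<bar> \<le> 2 * ?q * B * r"
          by (rule T_lipschitz_in_time[where g = f, OF f r(1)])
        also have "\<dots> \<le> 2 * ?q * B * h"
          using r lam_pos nu_pos \<open>B \<ge> 0\<close> by (intro mult_left_mono) auto
        finally show ?thesis .
      qed
      then have "\<bar>L (\<lambda>z. T r f z - f z) x\<bar> \<le> 2 * ?q * (2 * ?q * B * h)"
        by (rule abs_generator_le)
      also have "\<dots> = 4 * ?q\<^sup>2 * B * h" by (simp add: power2_eq_square algebra_simps)
      finally show "L (T r f) x - L f x \<le> 4 * ?q\<^sup>2 * B * h"
        by (simp add: generator_diff)
    qed
    then show ?thesis by (simp add: euler_def power2_eq_square)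
  qed
  have "T h (\<lambda>z. - g z) x = - T h g x" "euler h (\<lambda>z. - g z) x = - euler h g x"
    by (simp_all add: T_def euler_def generator_eq algebra_simps)
  then show ?thesis using le[of g] le[of "\<lambda>z. - g z"] assms(1) by (simp add: abs_le_iff)
qed

lemma euler_eq:
  "euler h g x = (1 - h * (lam + \<nu>)) * g x + h * lam * g (Suc x) + h * \<nu> * g (x - 1)"
  by (simp add: euler_def generator_eq algebra_simps)

text \<open>For these \<open>h\<close> the coefficients in \<open>euler_eq\<close> are nonnegative, so \<open>euler h\<close> is a Markov operator.\<close>

definition step_size :: "real \<Rightarrow> bool" where
  "step_size h \<longleftrightarrow> 0 \<le> h \<and> h * (lam + \<nu>) \<le> 1"

lemma euler_mono:
  assumes "step_size h" "\<And>z. f z \<le> g z"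
  shows "euler h f x \<le> euler h g x"
  unfolding euler_eq using assms lam_pos nu_pos
  by (intro add_mono mult_left_mono) (auto simp: step_size_def)

lemma euler_pow_mono:
  assumes "step_size h" "\<And>z. f z \<le> g z"
  shows "(euler h ^^ m) f x \<le> (euler h ^^ m) g x"
  using assms(2) by (induction m arbitrary: x) (auto intro: euler_mono[OF assms(1)])

lemma euler_cmult: "euler h (\<lambda>z. c * g z) = (\<lambda>z. c * euler h g z)"
  by (simp add: fun_eq_iff euler_eq algebra_simps)

lemma euler_pow_cmult: "(euler h ^^ m) (\<lambda>z. c * g z) = (\<lambda>z. c * (euler h ^^ m) g z)"
  by (induction m) (auto simp: euler_cmult)

lemma euler_diff: "euler h (\<lambda>z. f z - g z) x = euler h f x - euler h g x"
  by (simp add: euler_eq algebra_simps)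

lemma abs_euler_le:
  assumes "step_size h" "\<And>z. \<bar>g z\<bar> \<le> B"
  shows "\<bar>euler h g x\<bar> \<le> B"
proof -
  have "g z \<le> B" "- B \<le> g z" for z using assms(2)[of z] by auto
  then have "euler h g x \<le> euler h (\<lambda>_. B) x" "euler h (\<lambda>_. - B) x \<le> euler h g x"
    by (auto intro: euler_mono[OF assms(1)])
  then show ?thesis by (simp add: euler_def generator_eq)
qed

text \<open>Each step adds one local error, and \<open>euler h\<close> does not amplify the errors
  already accumulated.\<close>

lemma euler_pow_error:
  assumes h: "step_size h" and g: "\<And>z. \<bar>g z\<bar> \<le> B"
  shows "\<bar>T (real m * h) g x - (euler h ^^ m) g x\<bar> \<le> real m * (4 * (lam + \<nu>)\<^sup>2 * B * h\<^sup>2)"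
proof (induction m arbitrary: x)
  case (Suc m)
  let ?e = "4 * (lam + \<nu>)\<^sup>2 * B * h\<^sup>2" and ?u = "T (real m * h) g"
  have "h \<ge> 0" using h by (simp add: step_size_def)
  then have "T (real (Suc m) * h) g x = T h ?u x"
    using T_add[of h "real m * h" g B] g by (simp add: algebra_simps)
  moreover have "\<bar>T h ?u x - euler h ?u x\<bar> \<le> ?e"
    by (intro T_minus_euler abs_T_le g \<open>h \<ge> 0\<close>)
  moreover have "\<bar>euler h (\<lambda>z. ?u z - (euler h ^^ m) g z) x\<bar> \<le> real m * ?e"
    by (intro abs_euler_le h Suc.IH)
  ultimately show ?case by (simp add: euler_diff algebra_simps)
qed simp

lemma eventually_step_size:
  assumes "0 \<le> t"
  shows "\<forall>\<^sub>F m in sequentially. step_size (t / real m) \<and> real m * (t / real m) = t"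
proof -
  \<comment> \<open>Positivity of \<open>m\<close> matters because \<open>t / 0 = 0\<close>.\<close>
  have "\<forall>\<^sub>F m in sequentially. real m \<ge> t * (lam + \<nu>) \<and> m > 0"
    by (intro eventually_conj eventually_gt_at_top
        eventually_compose_filterlim[OF eventually_ge_at_top filterlim_real_sequentially])
  then show ?thesis
    by eventually_elim (use assms in \<open>auto simp: step_size_def field_simps\<close>)
qed

text \<open>The \<open>m\<close> local errors of order \<open>(t / real m)^2\<close> add up to order
  \<open>1 / real m\<close>.\<close>

lemma euler_tendsto:
  assumes g: "\<And>z. \<bar>g z\<bar> \<le> B" and "0 \<le> t"
  shows "(\<lambda>m. (euler (t / real m) ^^ m) g x) \<longlonglongrightarrow> T t g x"
proof (rule LIM_zero_cancel, rule Lim_null_comparison)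
  let ?c = "4 * (lam + \<nu>)\<^sup>2 * B * t\<^sup>2"
  show "\<forall>\<^sub>F m in sequentially. norm ((euler (t / real m) ^^ m) g x - T t g x) \<le> ?c * inverse (real m)"
    using eventually_step_size[OF assms(2)] eventually_gt_at_top[of 0]
  proof eventually_elim
    case (elim m)
    have "\<bar>T t g x - (euler (t / real m) ^^ m) g x\<bar>
        \<le> real m * (4 * (lam + \<nu>)\<^sup>2 * B * (t / real m)\<^sup>2)"
      using euler_pow_error[where g = g, OF elim(1)[THEN conjunct1] g, of m x]
      unfolding elim(1)[THEN conjunct2] .
    also have "\<dots> = ?c * inverse (real m)"
      using elim by (simp add: power2_eq_square divide_simps)
    finally show ?case by (simp add: abs_minus_commute)
  qed
  show "(\<lambda>m. ?c * inverse (real m)) \<longlonglongrightarrow> 0"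
    by (rule tendsto_mult_right_zero[OF lim_inverse_n])
qed

text \<open>This is synchronous coupling: from \<open>a\<close> and from \<open>b\<close> the same
  move is made with the same weight, and truncated subtraction does not increase distances.\<close>

lemma lip_euler:
  assumes h: "step_size h" and g: "lip C g"
  shows "lip C (euler h g)"
  unfolding lip_def
proof (intro allI)
  fix a b :: nat
  have "C \<ge> 0" using g[unfolded lip_def, rule_format, of 1 0] by simp
  let ?D = "C * \<bar>real a - real b\<bar>"
  have "\<bar>g (a - 1) - g (b - 1)\<bar> \<le> C * \<bar>real (a - 1) - real (b - 1)\<bar>"
    using g by (simp add: lip_def)
  also have "\<dots> \<le> ?D" using \<open>C \<ge> 0\<close> by (intro mult_left_mono) auto
  finally have D: "\<bar>g (a - 1) - g (b - 1)\<bar> \<le> ?D" .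
  have D': "\<bar>g a - g b\<bar> \<le> ?D" "\<bar>g (Suc a) - g (Suc b)\<bar> \<le> ?D"
    using g[unfolded lip_def, rule_format, of a b] g[unfolded lip_def, rule_format, of "Suc a" "Suc b"]
    by auto
  have "euler h g a - euler h g b = (1 - h * (lam + \<nu>)) * (g a - g b)
      + h * lam * (g (Suc a) - g (Suc b)) + h * \<nu> * (g (a - 1) - g (b - 1))"
    by (simp add: euler_eq algebra_simps)
  also have "\<bar>\<dots>\<bar> \<le> (1 - h * (lam + \<nu>)) * \<bar>g a - g b\<bar>
      + h * lam * \<bar>g (Suc a) - g (Suc b)\<bar> + h * \<nu> * \<bar>g (a - 1) - g (b - 1)\<bar>"
    using h lam_pos nu_pos
    by (intro abs_triangle_ineq[THEN order_trans] add_mono) (auto simp: abs_mult step_size_def)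
  also have "\<dots> \<le> (1 - h * (lam + \<nu>)) * ?D + h * lam * ?D + h * \<nu> * ?D"
    using h lam_pos nu_pos D D' by (intro add_mono mult_left_mono) (auto simp: step_size_def)
  also have "\<dots> = ?D" by (simp add: algebra_simps)
  finally show "\<bar>euler h g a - euler h g b\<bar> \<le> ?D" .
qed

lemma lip_euler_pow: "step_size h \<Longrightarrow> lip C g \<Longrightarrow> lip C ((euler h ^^ m) g)"
  by (induction m) (auto intro: lip_euler)

text \<open>With \<open>exp (\<theta> * g x)\<close> factored out, a jump contributes
  \<open>exp d - 1 = d + compensator d\<close>. The linear parts recombine to
  \<open>\<theta> * euler h g x\<close>, the compensators are bounded by their value at
  \<open>\<theta> * C\<close>, and \<open>1 + r \<le> exp r\<close> moves everything into the
  exponent.\<close>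

lemma euler_exp_le:
  assumes h: "step_size h" and g: "lip C g" and "0 \<le> \<theta>"
  shows "euler h (\<lambda>z. exp (\<theta> * g z)) x
           \<le> exp (h * (lam + \<nu>) * compensator (\<theta> * C)) * exp (\<theta> * euler h g x)"
proof -
  define d1 where "d1 = \<theta> * (g (Suc x) - g x)"
  define d2 where "d2 = \<theta> * (g (x - 1) - g x)"
  let ?c = "compensator (\<theta> * C)"
  have d: "\<bar>d1\<bar> \<le> \<theta> * C" "\<bar>d2\<bar> \<le> \<theta> * C"
    using lip_neighbours[OF g, of x] \<open>0 \<le> \<theta>\<close>
    by (auto simp: d1_def d2_def abs_mult intro!: mult_left_mono)
  have e: "exp d1 - 1 \<le> d1 + ?c" "exp d2 - 1 \<le> d2 + ?c"
    using d[THEN compensator_mono_abs] by (auto simp: compensator_def[of d1] compensator_def[of d2])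
  have "exp (\<theta> * g (Suc x)) = exp (\<theta> * g x) * exp d1" "exp (\<theta> * g (x - 1)) = exp (\<theta> * g x) * exp d2"
    by (auto simp: d1_def d2_def algebra_simps simp flip: exp_add)
  then have "euler h (\<lambda>z. exp (\<theta> * g z)) x
      = exp (\<theta> * g x) * (1 + (h * lam * (exp d1 - 1) + h * \<nu> * (exp d2 - 1)))"
    by (simp add: euler_eq algebra_simps)
  also have "\<dots> \<le> exp (\<theta> * g x) * exp (h * lam * (exp d1 - 1) + h * \<nu> * (exp d2 - 1))"
    by (intro mult_left_mono exp_ge_add_one_self) auto
  also have "\<dots> \<le> exp (\<theta> * g x) * exp (h * lam * (d1 + ?c) + h * \<nu> * (d2 + ?c))"
  proof -
    have "h * lam * (exp d1 - 1) + h * \<nu> * (exp d2 - 1) \<le> h * lam * (d1 + ?c) + h * \<nu> * (d2 + ?c)"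
      using e h lam_pos nu_pos by (intro add_mono mult_left_mono) (auto simp: step_size_def)
    then show ?thesis by simp
  qed
  also have "\<dots> = exp (h * (lam + \<nu>) * ?c) * exp (\<theta> * euler h g x)"
    unfolding exp_add[symmetric] d1_def d2_def euler_eq by (simp add: algebra_simps)
  finally show ?thesis .
qed

text \<open>The innermost step is estimated first, leaving \<open>euler h g\<close> in place of
  \<open>g\<close>; this is why \<open>g\<close> is arbitrary in the induction.\<close>

lemma euler_pow_exp_le:
  assumes h: "step_size h" and g: "lip C g" and "0 \<le> \<theta>"
  shows "(euler h ^^ m) (\<lambda>z. exp (\<theta> * g z)) x
           \<le> exp (real m * h * (lam + \<nu>) * compensator (\<theta> * C)) * exp (\<theta> * (euler h ^^ m) g x)"
  using g
proof (induction m arbitrary: g)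
  case (Suc m)
  let ?c = "compensator (\<theta> * C)"
  have "(euler h ^^ Suc m) (\<lambda>z. exp (\<theta> * g z)) x = (euler h ^^ m) (euler h (\<lambda>z. exp (\<theta> * g z))) x"
    by (simp add: funpow_swap1)
  also have "\<dots> \<le> (euler h ^^ m) (\<lambda>z. exp (h * (lam + \<nu>) * ?c) * exp (\<theta> * euler h g z)) x"
    by (intro euler_pow_mono euler_exp_le h Suc.prems assms(3))
  also have "\<dots> = exp (h * (lam + \<nu>) * ?c) * (euler h ^^ m) (\<lambda>z. exp (\<theta> * euler h g z)) x"
    by (simp add: euler_pow_cmult)
  also have "\<dots> \<le> exp (h * (lam + \<nu>) * ?c)
      * (exp (real m * h * (lam + \<nu>) * ?c) * exp (\<theta> * (euler h ^^ m) (euler h g) x))"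
    by (intro mult_left_mono Suc.IH lip_euler h Suc.prems) auto
  also have "\<dots> = exp (real (Suc m) * h * (lam + \<nu>) * ?c) * exp (\<theta> * (euler h ^^ Suc m) g x)"
    by (simp add: funpow_swap1 algebra_simps flip: exp_add)
  finally show ?case .
qed simp

text \<open>A drift bound that involves no bound on \<open>\<bar>g\<bar>\<close>: \<open>L\<close>
  maps a \<open>C\<close>-Lipschitz function below \<open>(lam + \<nu>) * C\<close>. It later
  controls the means of truncations uniformly in the truncation level.\<close>

lemma euler_pow_le:
  assumes h: "step_size h" and g: "lip C g"
  shows "(euler h ^^ m) g x \<le> g x + real m * h * (lam + \<nu>) * C"
proof (induction m)
  case (Suc m)
  let ?u = "(euler h ^^ m) g"
  have "lip C ?u" by (rule lip_euler_pow[OF h g])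
  then have "?u (Suc x) - ?u x \<le> C" "?u (x - 1) - ?u x \<le> C"
    using lip_neighbours[of C ?u x] by auto
  then have "L ?u x \<le> lam * C + \<nu> * C"
    unfolding generator_eq using lam_pos nu_pos by (intro add_mono mult_left_mono) auto
  then have "h * L ?u x \<le> h * (lam * C + \<nu> * C)"
    using h by (intro mult_left_mono) (auto simp: step_size_def)
  moreover have "(euler h ^^ Suc m) g x = ?u x + h * L ?u x" by (simp add: euler_def[of h ?u])
  ultimately show ?case using Suc.IH by (simp add: algebra_simps)
qed simp

lemma lip_T:
  assumes g: "\<And>z. \<bar>g z\<bar> \<le> B" and "0 \<le> t" "lip C g"
  shows "lip C (T t g)"
  unfolding lip_def
proof (intro allI)
  fix a b
  have "(\<lambda>m. \<bar>(euler (t / real m) ^^ m) g a - (euler (t / real m) ^^ m) g b\<bar>) \<longlonglongrightarrow> \<bar>T t g a - T t g b\<bar>"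
    by (intro tendsto_intros euler_tendsto[where g = g, OF g] assms(2))
  moreover have "\<forall>\<^sub>F m in sequentially.
      \<bar>(euler (t / real m) ^^ m) g a - (euler (t / real m) ^^ m) g b\<bar> \<le> C * \<bar>real a - real b\<bar>"
    using eventually_step_size[OF assms(2)]
    by eventually_elim (use lip_euler_pow[OF _ assms(3)] in \<open>auto simp: lip_def\<close>)
  ultimately show "\<bar>T t g a - T t g b\<bar> \<le> C * \<bar>real a - real b\<bar>"
    by (rule tendsto_upperbound) simp
qed

lemma T_exp_le:
  assumes g: "\<And>z. \<bar>g z\<bar> \<le> B" and t: "0 \<le> t" and "lip C g" "0 \<le> \<theta>"
  shows "T t (\<lambda>z. exp (\<theta> * g z)) x
           \<le> exp (t * (lam + \<nu>) * compensator (\<theta> * C)) * exp (\<theta> * T t g x)"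
proof (rule tendsto_le[OF sequentially_bot])
  have "\<bar>exp (\<theta> * g z)\<bar> \<le> exp (\<theta> * B)" for z
    using g[of z] \<open>0 \<le> \<theta>\<close> by (auto intro!: mult_left_mono)
  then show "(\<lambda>m. (euler (t / real m) ^^ m) (\<lambda>z. exp (\<theta> * g z)) x) \<longlonglongrightarrow> T t (\<lambda>z. exp (\<theta> * g z)) x"
    by (rule euler_tendsto[OF _ t])
  show "(\<lambda>m. exp (t * (lam + \<nu>) * compensator (\<theta> * C)) * exp (\<theta> * (euler (t / real m) ^^ m) g x))
      \<longlonglongrightarrow> exp (t * (lam + \<nu>) * compensator (\<theta> * C)) * exp (\<theta> * T t g x)"
    by (intro tendsto_intros euler_tendsto[where g = g, OF g t])
  show "\<forall>\<^sub>F m in sequentially. (euler (t / real m) ^^ m) (\<lambda>z. exp (\<theta> * g z)) x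
      \<le> exp (t * (lam + \<nu>) * compensator (\<theta> * C)) * exp (\<theta> * (euler (t / real m) ^^ m) g x)"
    using eventually_step_size[OF t]
  proof eventually_elim
    case (elim m)
    then show ?case using euler_pow_exp_le[of "t / real m" C g \<theta> m x] assms(3,4) by simp
  qed
qed

lemma T_le:
  assumes g: "\<And>z. \<bar>g z\<bar> \<le> B" and t: "0 \<le> t" and "lip C g"
  shows "T t g x \<le> g x + t * (lam + \<nu>) * C"
proof (rule tendsto_upperbound[OF euler_tendsto[where g = g, OF g t]])
  show "\<forall>\<^sub>F m in sequentially. (euler (t / real m) ^^ m) g x \<le> g x + t * (lam + \<nu>) * C"
    using eventually_step_size[OF t]
  proof eventually_elim
    case (elim m)
    then show ?case using euler_pow_le[of "t / real m" C g m x] assms(3) by simp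
  qed
qed simp

end

section \<open>The l1 distance and the Lipschitz norm\<close>

lemma l1_dist_append:
  assumes "length xs = length ys"
  shows "l1_dist (xs @ [a]) (ys @ [b]) = l1_dist xs ys + \<bar>real a - real b\<bar>"
  using assms by (simp add: l1_dist_def nth_append)

lemma l1_dist_self [simp]: "l1_dist xs xs = 0"
  by (simp add: l1_dist_def)

lemma l1_dist_pos:
  assumes "length xs = length ys" "xs \<noteq> ys"
  shows "0 < l1_dist xs ys"
proof -
  obtain i where "i < length xs" "xs ! i \<noteq> ys ! i" using assms nth_equalityI by blast
  then show ?thesis unfolding l1_dist_def by (intro sum_pos2[of _ i]) auto
qed

lemma l1_lipschitz_bound:
  assumes "l1_lipschitz n f" "length xs = n" "length ys = n"
  shows "\<bar>f xs - f ys\<bar> \<le> lip_norm n f * l1_dist xs ys"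
proof (cases "xs = ys")
  case False
  then have "\<bar>f xs - f ys\<bar> / l1_dist xs ys \<in> lip_quotients n f"
    using assms(2,3) by (auto simp: lip_quotients_def)
  then have "\<bar>f xs - f ys\<bar> / l1_dist xs ys \<le> lip_norm n f"
    using assms(1) unfolding lip_norm_def l1_lipschitz_def by (intro cSup_upper)
  then show ?thesis using l1_dist_pos[of xs ys] False assms(2,3) by (simp add: divide_simps)
qed simp

text \<open>For \<open>n \<ge> 1\<close> two distinct lists exist; for \<open>n = 0\<close> the
  supremum would range over the empty set.\<close>

lemma lip_norm_nonneg:
  assumes "l1_lipschitz n f" "n \<ge> 1"
  shows "0 \<le> lip_norm n f"
proof -
  have "0 < l1_dist (replicate n 0) (replicate n 1)"
    using assms(2) by (intro l1_dist_pos) auto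
  moreover have "0 \<le> lip_norm n f * l1_dist (replicate n 0) (replicate n 1)"
    using order_trans[OF abs_ge_zero l1_lipschitz_bound[OF assms(1)]] by simp
  ultimately show ?thesis by (simp add: zero_le_mult_iff)
qed

section \<open>The law of the sample\<close>

text \<open>New states are appended at the end, so that unfolding the recursion integrates out the
  last sampling time first. The current state is \<open>last (x # xs)\<close>, which is
  \<open>x\<close> before the first sample.\<close>

primrec joint_law :: "(real \<Rightarrow> nat \<Rightarrow> nat pmf) \<Rightarrow> (nat \<Rightarrow> real) \<Rightarrow> nat \<Rightarrow> nat \<Rightarrow> nat list pmf" where
  "joint_law P t x 0 = return_pmf []"
| "joint_law P t x (Suc m) = bind_pmf (joint_law P t x m)
     (\<lambda>xs. map_pmf (\<lambda>z. xs @ [z]) (P (t (Suc m) - t m) (last (x # xs))))"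

lemma length_joint_law: "xs \<in> set_pmf (joint_law P t x m) \<Longrightarrow> length xs = m"
  by (induction m arbitrary: xs) auto

lemma sampling_times_mono:
  fixes t :: "nat \<Rightarrow> real"
  assumes "\<And>i. i < n \<Longrightarrow> t i < t (Suc i)" "i \<le> j" "j \<le> n"
  shows "t i \<le> t j"
  using assms(2,3)
proof (induction j rule: dec_induct)
  case (step j)
  then show ?case using assms(1)[of j] by auto
qed simp

text \<open>The chain rule for conditional probabilities, with the Markov property as the factor of
  each step. Where the conditioning event is null, that property says nothing, but both sides are
  0.\<close>

lemma prob_sample_path:
  assumes chain: "markov_chain_from P x M X"
    and t: "t 0 = 0" "\<And>i. i < n \<Longrightarrow> t i < t (Suc i)"
    and "m \<le> n" "length zs = m"
  shows "measure M {\<omega> \<in> space M. \<forall>k\<le>m. X (t k) \<omega> = (x # zs) ! k} = pmf (joint_law P t x m) zs"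
  using assms(4,5)
proof (induction m arbitrary: zs)
  case 0
  interpret prob_space M using chain by (simp add: markov_chain_from_def)
  have "AE \<omega> in M. X 0 \<omega> = x" using chain by (simp add: markov_chain_from_def)
  moreover have [measurable]: "X 0 \<in> measurable M (count_space UNIV)"
    using chain by (simp add: markov_chain_from_def)
  ultimately have "measure M {\<omega> \<in> space M. X 0 \<omega> = x} = 1"
    by (subst prob_Collect_eq_1) auto
  then show ?case using 0 t(1) by simp
next
  case (Suc m)
  interpret prob_space M using chain by (simp add: markov_chain_from_def)
  have X [measurable]: "X (t k) \<in> measurable M (count_space UNIV)" if "k \<le> n" for k
    using chain sampling_times_mono[of n t 0 k] t that by (auto simp: markov_chain_from_def)
  obtain ys w where zs: "zs = ys @ [w]" "length ys = m"
    using Suc.prems(2) by (metis length_Suc_conv_rev)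
  let ?z = "\<lambda>k. (x # zs) ! k"
  let ?Q = "\<lambda>\<omega>. \<forall>k\<le>m. X (t k) \<omega> = ?z k"
  have zm: "?z m = last (x # ys)" "?z (Suc m) = w"
    using zs by (auto simp: nth_append last_conv_nth nth_Cons')
  have "?z k = (x # ys) ! k" if "k \<le> m" for k
    using that zs by (auto simp: nth_Cons' nth_append)
  then have "{\<omega> \<in> space M. ?Q \<omega>} = {\<omega> \<in> space M. \<forall>k\<le>m. X (t k) \<omega> = (x # ys) ! k}"
    by auto
  then have Q: "measure M {\<omega> \<in> space M. ?Q \<omega>} = pmf (joint_law P t x m) ys"
    using Suc.IH[of ys] Suc.prems zs by simp
  have "{\<omega> \<in> space M. ?Q \<omega>} = space M \<inter> (\<Inter>k\<le>m. {\<omega> \<in> space M. X (t k) \<omega> = ?z k})"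
    by auto
  also have "\<dots> \<in> sets M" using Suc.prems(1) by (intro sets.Int sets.top sets.finite_INT) auto
  finally have Qm: "{\<omega> \<in> space M. ?Q \<omega>} \<in> sets M" .
  have split: "{\<omega> \<in> space M. \<forall>k\<le>Suc m. X (t k) \<omega> = ?z k}
      = {\<omega> \<in> space M. X (t (Suc m)) \<omega> = ?z (Suc m) \<and> ?Q \<omega>}"
    by (auto simp: le_Suc_eq)
  have "measure M {\<omega> \<in> space M. X (t (Suc m)) \<omega> = ?z (Suc m) \<and> ?Q \<omega>}
      = pmf (joint_law P t x m) ys * pmf (P (t (Suc m) - t m) (last (x # ys))) w"
  proof (cases "measure M {\<omega> \<in> space M. ?Q \<omega>} > 0")
    case True
    have "0 \<le> t 0" "\<forall>k\<le>m. t k < t (Suc k)" using t Suc.prems(1) by auto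
    with True have "cond_prob M (\<lambda>\<omega>. X (t (Suc m)) \<omega> = ?z (Suc m)) ?Q
        = pmf (P (t (Suc m) - t m) (?z m)) (?z (Suc m))"
      using chain unfolding markov_chain_from_def by blast
    then show ?thesis using True unfolding cond_prob_def zm Q by (simp add: field_simps)
  next
    case False
    then have "measure M {\<omega> \<in> space M. ?Q \<omega>} = 0"
      using measure_nonneg[of M "{\<omega> \<in> space M. ?Q \<omega>}"] by linarith
    moreover have "measure M {\<omega> \<in> space M. X (t (Suc m)) \<omega> = ?z (Suc m) \<and> ?Q \<omega>}
        \<le> measure M {\<omega> \<in> space M. ?Q \<omega>}"
      by (intro finite_measure_mono Qm) auto
    ultimately have "measure M {\<omega> \<in> space M. X (t (Suc m)) \<omega> = ?z (Suc m) \<and> ?Q \<omega>} = 0"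
        "pmf (joint_law P t x m) ys = 0"
      using measure_nonneg[of M "{\<omega> \<in> space M. X (t (Suc m)) \<omega> = ?z (Suc m) \<and> ?Q \<omega>}"] Q
      by linarith+
    then show ?thesis by simp
  qed
  then show ?case unfolding split by (simp add: zs(1) pmf_bind_append)
qed

lemma distr_sample:
  assumes chain: "markov_chain_from P x M X"
    and t: "t 0 = 0" "\<And>i. i < n \<Longrightarrow> t i < t (Suc i)"
  shows "sample X t n \<in> measurable M (count_space UNIV)"
    and "distr M (count_space UNIV) (sample X t n) = measure_pmf (joint_law P t x n)"
proof -
  interpret prob_space M using chain by (simp add: markov_chain_from_def)
  have X [measurable]: "X (t k) \<in> measurable M (count_space UNIV)" if "k \<le> n" for k
    using chain sampling_times_mono[of n t 0 k] t that by (auto simp: markov_chain_from_def)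
  have length_sample: "length (sample X t n \<omega>) = n" for \<omega> by (simp add: sample_def del: upt_Suc)
  have sample_eq: "sample X t n \<omega> = zs \<longleftrightarrow> length zs = n \<and> (\<forall>k<n. X (t (Suc k)) \<omega> = zs ! k)" for \<omega> zs
    by (auto simp: sample_def list_eq_iff_nth_eq simp del: upt_Suc)
  have vimage: "sample X t n -` {zs} \<inter> space M \<in> sets M" for zs
  proof (cases "length zs = n")
    case True
    then have "sample X t n \<omega> = zs \<longleftrightarrow> (\<forall>k<n. X (t (Suc k)) \<omega> = zs ! k)" for \<omega>
      using sample_eq[of \<omega> zs] by blast
    then have "sample X t n -` {zs} \<inter> space M
        = space M \<inter> (\<Inter>k<n. {\<omega> \<in> space M. X (t (Suc k)) \<omega> = zs ! k})"
      by auto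
    also have "\<dots> \<in> sets M"
      by (cases "n = 0") (auto intro!: sets.finite_INT)
    finally show ?thesis .
  qed (simp add: sample_eq vimage_def)
  show meas: "sample X t n \<in> measurable M (count_space UNIV)"
    by (rule measurable_count_space_eq_countable[THEN iffD2]) (use vimage in auto)
  show "distr M (count_space UNIV) (sample X t n) = measure_pmf (joint_law P t x n)"
  proof (rule measure_eqI_countable[where A = UNIV])
    fix zs
    have "measure M (sample X t n -` {zs} \<inter> space M) = pmf (joint_law P t x n) zs"
    proof (cases "length zs = n")
      case True
      have [measurable]: "X 0 \<in> measurable M (count_space UNIV)" using X[of 0] t(1) by simp
      have X0: "AE \<omega> in M. X 0 \<omega> = x" using chain by (simp add: markov_chain_from_def)
      have this_sample: "sample X t n \<omega> = zs \<longleftrightarrow> (\<forall>k<n. X (t (Suc k)) \<omega> = zs ! k)" for \<omega>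
        using sample_eq[of \<omega> zs] True by blast
      have all_le: "(\<forall>k\<le>n. Q k) \<longleftrightarrow> Q 0 \<and> (\<forall>k<n. Q (Suc k))" for Q
        by (metis Suc_le_eq not0_implies_Suc zero_le)
      \<comment> \<open>The sample starts at index 1, whereas the path event also fixes the state at
        time 0; this extra condition has probability 1.\<close>
      have eq: "{\<omega> \<in> space M. \<forall>k\<le>n. X (t k) \<omega> = (x # zs) ! k}
          = {\<omega> \<in> space M. X 0 \<omega> = x} \<inter> (sample X t n -` {zs} \<inter> space M)"
        unfolding all_le t(1) nth_Cons_0 nth_Cons_Suc
        by (simp only: set_eq_iff Int_iff mem_Collect_eq vimage_singleton_eq this_sample) blast
      have "measure M (sample X t n -` {zs} \<inter> space M)
          = measure M ({\<omega> \<in> space M. X 0 \<omega> = x} \<inter> (sample X t n -` {zs} \<inter> space M))"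
        by (rule finite_measure_eq_AE) (use X0 vimage in auto)
      then show ?thesis
        using prob_sample_path[where n = n and zs = zs, OF chain t order_refl True] eq by simp
    next
      case False
      then have "sample X t n -` {zs} \<inter> space M = {}" using length_sample by auto
      moreover have "zs \<notin> set_pmf (joint_law P t x n)" using False length_joint_law by blast
      ultimately show ?thesis by (simp add: set_pmf_iff)
    qed
    then show "emeasure (distr M (count_space UNIV) (sample X t n)) {zs}
        = emeasure (measure_pmf (joint_law P t x n)) {zs}"
      using meas by (simp add: emeasure_distr emeasure_eq_measure emeasure_pmf_single)
  qed auto
qed

section \<open>Backward integration over the sampling times\<close>

text \<open>
  The extra weight \<open>A\<close> on the last coordinate is what integrating out the later coordinates leaves
  behind. Prepending the initial state \<open>x\<close> gives a meaning to the last coordinate of the empty list.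
\<close>

definition path_lip :: "nat \<Rightarrow> nat \<Rightarrow> real \<Rightarrow> real \<Rightarrow> (nat list \<Rightarrow> real) \<Rightarrow> bool" where
  "path_lip x m K A f \<longleftrightarrow> (\<forall>xs ys. length xs = m \<longrightarrow> length ys = m \<longrightarrow>
     \<bar>f xs - f ys\<bar> \<le> K * l1_dist xs ys + A * \<bar>real (last (x # xs)) - real (last (x # ys))\<bar>)"

text \<open>Meant for truncations \<open>c\<close>, which make \<open>f\<close> bounded and keep its
  constants.\<close>

lemma path_lip_compose:
  assumes "path_lip x m K A f" "\<And>u v. \<bar>c u - c v\<bar> \<le> \<bar>u - v\<bar>"
  shows "path_lip x m K A (\<lambda>xs. c (f xs))"
  using assms order_trans unfolding path_lip_def by blast

text \<open>A change of the last entry counts twice, through the distance with factor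
  \<open>K\<close> and through the weight \<open>A\<close>.\<close>

lemma path_lip_last:
  assumes "path_lip x (Suc m) K A f" "length xs = m"
  shows "lip (A + K) (\<lambda>z. f (xs @ [z]))"
  unfolding lip_def
proof (intro allI)
  fix a b
  have "\<bar>f (xs @ [a]) - f (xs @ [b])\<bar> \<le> K * l1_dist (xs @ [a]) (xs @ [b]) + A * \<bar>real a - real b\<bar>"
    using assms unfolding path_lip_def by (metis last_ConsR last_snoc length_append_singleton snoc_eq_iff_butlast)
  also have "\<dots> = (A + K) * \<bar>real a - real b\<bar>"
    by (simp add: l1_dist_append algebra_simps)
  finally show "\<bar>f (xs @ [a]) - f (xs @ [b])\<bar> \<le> (A + K) * \<bar>real a - real b\<bar>" .
qed

context mm1_semigroup
begin

text \<open>First the integrand is changed from \<open>xs\<close> to \<open>ys\<close> with the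
  starting state fixed, then the starting state is changed; \<open>lip_T\<close> controls the second
  change.\<close>

lemma path_lip_integrate_last:
  assumes f: "path_lip x (Suc m) K A f" and B: "\<And>xs. \<bar>f xs\<bar> \<le> B" and "0 \<le> s"
  shows "path_lip x m K (A + K) (\<lambda>xs. T s (\<lambda>z. f (xs @ [z])) (last (x # xs)))"
  unfolding path_lip_def
proof (intro allI impI)
  fix xs ys :: "nat list" assume len: "length xs = m" "length ys = m"
  let ?a = "last (x # xs)" and ?b = "last (x # ys)"
  let ?f = "\<lambda>z. f (xs @ [z])" and ?g = "\<lambda>z. f (ys @ [z])"
  \<comment> \<open>Both extended lists end in \<open>z\<close>, so the \<open>A\<close> term is
    zero.\<close>
  have "\<bar>?f z - ?g z\<bar> \<le> K * l1_dist xs ys" for z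
    using f[unfolded path_lip_def, rule_format, of "xs @ [z]" "ys @ [z]"] len
    by (simp add: l1_dist_append)
  then have "\<bar>T s (\<lambda>z. ?f z - ?g z) ?a\<bar> \<le> K * l1_dist xs ys" by (rule abs_T_le)
  moreover have "T s (\<lambda>z. ?f z - ?g z) ?a = T s ?f ?a - T s ?g ?a"
    by (rule T_diff[where A = B and B = B]) (rule B)+
  moreover have "lip (A + K) (T s ?g)"
    by (rule lip_T[where B = B]) (auto intro: B assms(3) path_lip_last[OF f len(2)])
  then have "\<bar>T s ?g ?a - T s ?g ?b\<bar> \<le> (A + K) * \<bar>real ?a - real ?b\<bar>"
    unfolding lip_def by blast
  ultimately show "\<bar>T s ?f ?a - T s ?g ?b\<bar> \<le> K * l1_dist xs ys + (A + K) * \<bar>real ?a - real ?b\<bar>"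
    by linarith
qed

abbreviation E :: "(nat \<Rightarrow> real) \<Rightarrow> nat \<Rightarrow> nat \<Rightarrow> (nat list \<Rightarrow> real) \<Rightarrow> real" where
  "E t x m f \<equiv> measure_pmf.expectation (joint_law P t x m) f"

lemma E_Suc:
  assumes "\<And>xs. \<bar>f xs\<bar> \<le> B"
  shows "E t x (Suc m) f = E t x m (\<lambda>xs. T (t (Suc m) - t m) (\<lambda>z. f (xs @ [z])) (last (x # xs)))"
  using assms by (simp add: expectation_bind_pmf[where g = f and B = B] T_def)

text \<open>Integrating out one coordinate lowers \<open>m\<close> by one and raises
  \<open>A\<close> by \<open>K\<close>, so \<open>A + real m * K\<close> is invariant and one
  \<open>C\<close> serves all steps. The second bound does not involve \<open>B\<close> and is what
  gives integrability of unbounded functions.\<close>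

lemma joint_law_bounds:
  assumes t: "t 0 = 0" "\<And>i. i < m \<Longrightarrow> t i < t (Suc i)"
    and "path_lip x m K A f" "\<And>xs. \<bar>f xs\<bar> \<le> B"
    and "0 \<le> K" "A + real m * K \<le> C" "0 \<le> \<theta>"
  shows "E t x m (\<lambda>xs. exp (\<theta> * f xs))
           \<le> exp (t m * (lam + \<nu>) * compensator (\<theta> * C)) * exp (\<theta> * E t x m f)
       \<and> E t x m f \<le> f (replicate m x) + t m * (lam + \<nu>) * C"
  using assms
proof (induction m arbitrary: A f)
  case 0
  then show ?case by simp
next
  case (Suc m)
  note f = Suc.prems(3) and B = Suc.prems(4) and K = Suc.prems(5) and \<theta> = Suc.prems(7)
  define s where "s = t (Suc m) - t m"
  define F where "F xs = T s (\<lambda>z. f (xs @ [z])) (last (x # xs))" for xs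
  let ?e = "\<lambda>r. exp (r * (lam + \<nu>) * compensator (\<theta> * C))"
  have s: "0 \<le> s" using Suc.prems(2)[of m] by (simp add: s_def)
  have FB: "\<bar>F xs\<bar> \<le> B" for xs unfolding F_def by (intro abs_T_le B)
  have F: "path_lip x m K (A + K) F"
    unfolding F_def by (rule path_lip_integrate_last[OF f B s])
  have IH: "E t x m (\<lambda>xs. exp (\<theta> * F xs)) \<le> ?e (t m) * exp (\<theta> * E t x m F)"
      "E t x m F \<le> F (replicate m x) + t m * (lam + \<nu>) * C"
    using Suc.IH[OF Suc.prems(1) _ F FB K _ \<theta>] Suc.prems(2,6) by (auto simp: algebra_simps)
  have "0 \<le> real m * K" using K by simp
  then have AK: "A + K \<le> C" using Suc.prems(6) unfolding of_nat_Suc distrib_right by linarith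
  have lipC: "lip C (\<lambda>z. f (xs @ [z]))" if "length xs = m" for xs
    by (rule lip_mono[OF path_lip_last[OF f that] AK])
  have EF: "E t x (Suc m) f = E t x m F"
    unfolding F_def s_def by (rule E_Suc[where B = B]) (rule B)
  have expB: "\<bar>exp (\<theta> * g)\<bar> \<le> exp (\<theta> * B)" if "\<bar>g\<bar> \<le> B" for g
    using that \<theta> by (auto intro!: mult_left_mono)
  have "E t x (Suc m) (\<lambda>xs. exp (\<theta> * f xs))
      = E t x m (\<lambda>xs. T s (\<lambda>z. exp (\<theta> * f (xs @ [z]))) (last (x # xs)))"
    unfolding s_def by (rule E_Suc[where B = "exp (\<theta> * B)"]) (rule expB[OF B])
  also have "\<dots> \<le> E t x m (\<lambda>xs. ?e s * exp (\<theta> * F xs))"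
  proof (rule integral_mono_AE)
    show "integrable (measure_pmf (joint_law P t x m))
        (\<lambda>xs. T s (\<lambda>z. exp (\<theta> * f (xs @ [z]))) (last (x # xs)))"
      by (rule integrable_pmf_bounded[where B = "exp (\<theta> * B)"]) (intro abs_T_le expB[OF B])
    show "integrable (measure_pmf (joint_law P t x m)) (\<lambda>xs. ?e s * exp (\<theta> * F xs))"
      by (intro integrable_mult_right integrable_pmf_bounded[where B = "exp (\<theta> * B)"] expB[OF FB])
    show "AE xs in joint_law P t x m.
        T s (\<lambda>z. exp (\<theta> * f (xs @ [z]))) (last (x # xs)) \<le> ?e s * exp (\<theta> * F xs)"
      unfolding AE_measure_pmf_iff F_def
      by (intro ballI T_exp_le[where B = B] B s lipC \<theta>) (rule length_joint_law)
  qed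
  also have "\<dots> = ?e s * E t x m (\<lambda>xs. exp (\<theta> * F xs))" by simp
  also have "\<dots> \<le> ?e s * (?e (t m) * exp (\<theta> * E t x m F))"
    by (intro mult_left_mono IH) simp
  also have "\<dots> = ?e (t (Suc m)) * exp (\<theta> * E t x (Suc m) f)"
    unfolding EF s_def by (simp add: algebra_simps flip: exp_add)
  finally have "E t x (Suc m) (\<lambda>xs. exp (\<theta> * f xs)) \<le> ?e (t (Suc m)) * exp (\<theta> * E t x (Suc m) f)" .
  \<comment> \<open>The reference path stays at \<open>x\<close>, so the drift bound starts from
    \<open>x\<close> and appending \<open>x\<close> gives the next reference path.\<close>
  moreover have "F (replicate m x) \<le> f (replicate m x @ [x]) + s * (lam + \<nu>) * C"
  proof -
    have "last (x # replicate m x) = x" by (induction m) auto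
    moreover have "T s (\<lambda>z. f (replicate m x @ [z])) x \<le> f (replicate m x @ [x]) + s * (lam + \<nu>) * C"
      by (rule T_le[where B = B and g = "\<lambda>z. f (replicate m x @ [z])"]) (auto intro: B s lipC)
    ultimately show ?thesis by (simp add: F_def)
  qed
  moreover have "replicate m x @ [x] = replicate (Suc m) x"
    by (simp add: replicate_append_same)
  ultimately show ?case using IH(2) EF by (simp add: s_def algebra_simps)
qed

text \<open>Monotone convergence along \<open>min r \<bar>f\<bar>\<close>: the mean bound of
  \<open>joint_law_bounds\<close>, taken with \<open>\<theta> = 0\<close>, gives the same
  \<open>c\<close> for every level \<open>r\<close>.\<close>

lemma joint_law_integrable:
  assumes t: "t 0 = 0" "\<And>i. i < m \<Longrightarrow> t i < t (Suc i)"
    and f: "path_lip x m K 0 f" and "0 \<le> K"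
  shows "integrable (measure_pmf (joint_law P t x m)) f"
proof -
  let ?p = "measure_pmf (joint_law P t x m)"
  let ?g = "\<lambda>r xs. min (real r) \<bar>f xs\<bar>"
  define c where "c = \<bar>f (replicate m x)\<bar> + t m * (lam + \<nu>) * (real m * K)"
  have "integral\<^sup>N ?p (?g r) \<le> ennreal c" for r
  proof -
    have "path_lip x m K 0 (?g r)"
      by (rule path_lip_compose[OF f]) auto
    then have "integral\<^sup>L ?p (?g r) \<le> ?g r (replicate m x) + t m * (lam + \<nu>) * (real m * K)"
      using joint_law_bounds[where \<theta> = 0 and B = "real r" and A = 0 and f = "?g r"] t assms(4) by auto
    also have "\<dots> \<le> c" by (simp add: c_def)
    finally have "integral\<^sup>L ?p (?g r) \<le> c" .
    moreover have "integral\<^sup>N ?p (?g r) = ennreal (integral\<^sup>L ?p (?g r))"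
      by (rule nn_integral_eq_integral) (auto intro: integrable_pmf_bounded[where B = "real r"])
    ultimately show ?thesis by (simp add: ennreal_leI)
  qed
  moreover have "(\<lambda>r. integral\<^sup>N ?p (?g r)) \<longlonglongrightarrow> integral\<^sup>N ?p (\<lambda>xs. ennreal \<bar>f xs\<bar>)"
  proof (rule nn_integral_LIMSEQ)
    show "incseq (\<lambda>r xs. ennreal (?g r xs))"
      by (auto simp: incseq_def le_fun_def intro!: ennreal_leI)
    fix xs
    have "\<forall>\<^sub>F r in sequentially. ?g r xs = \<bar>f xs\<bar>"
      using eventually_compose_filterlim[OF eventually_ge_at_top[of "\<bar>f xs\<bar>"] filterlim_real_sequentially]
      by eventually_elim simp
    then show "(\<lambda>r. ennreal (?g r xs)) \<longlonglongrightarrow> ennreal \<bar>f xs\<bar>"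
      by (intro tendsto_ennrealI tendsto_eventually)
  qed auto
  ultimately have "integral\<^sup>N ?p (\<lambda>xs. ennreal \<bar>f xs\<bar>) \<le> ennreal c"
    by (intro LIMSEQ_le_const2) auto
  then show ?thesis
    by (intro integrableI_bounded) (auto intro: le_less_trans)
qed

text \<open>Chernoff's bound is applied to the truncations \<open>g r\<close>; their means tend to
  that of \<open>f\<close> by dominated convergence, and the bound passes to the limit.\<close>

lemma joint_law_tail:
  assumes t: "t 0 = 0" "\<And>i. i < m \<Longrightarrow> t i < t (Suc i)"
    and f: "path_lip x m K 0 f" and "0 \<le> K" "real m * K \<le> C" and \<theta>: "0 \<le> \<theta>"
  shows "measure (measure_pmf (joint_law P t x m)) {xs. f xs - E t x m f \<ge> y}
           \<le> exp (t m * (lam + \<nu>) * compensator (\<theta> * C) - \<theta> * y)"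
proof (rule tendsto_lowerbound)
  let ?p = "measure_pmf (joint_law P t x m)"
  let ?a = "t m * (lam + \<nu>) * compensator (\<theta> * C)"
  define g where "g r xs = max (- r) (min r (f xs))" for r xs
  have If: "integrable ?p f" by (rule joint_law_integrable[where f = f and t = t, OF t f assms(4)])
  have "((\<lambda>r. E t x m (g r)) \<longlongrightarrow> E t x m f) at_top"
  proof (rule integral_dominated_convergence_at_top[where w = "\<lambda>xs. \<bar>f xs\<bar>"])
    show "\<forall>\<^sub>F r in at_top. AE xs in ?p. norm (g r xs) \<le> \<bar>f xs\<bar>"
      using eventually_ge_at_top[of 0] by eventually_elim (auto simp: g_def)
    have "((\<lambda>r. g r xs) \<longlongrightarrow> f xs) at_top" for xs
      using eventually_ge_at_top[of "\<bar>f xs\<bar>"]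
      by (intro tendsto_eventually, eventually_elim) (auto simp: g_def)
    then show "AE xs in ?p. ((\<lambda>r. g r xs) \<longlongrightarrow> f xs) at_top" by simp
  qed (use If in auto)
  then have "((\<lambda>r. exp (?a - \<theta> * (y + (E t x m f - E t x m (g r))))) \<longlongrightarrow>
      exp (?a - \<theta> * (y + (E t x m f - E t x m f)))) at_top"
    by (intro tendsto_intros)
  then show "((\<lambda>r. exp (?a - \<theta> * (y + (E t x m f - E t x m (g r))))) \<longlongrightarrow> exp (?a - \<theta> * y)) at_top"
    by simp
  have "measure ?p {xs. f xs - E t x m f \<ge> y} \<le> exp (?a - \<theta> * (y + (E t x m f - E t x m (g r))))"
    if r: "r \<ge> \<bar>y + E t x m f\<bar>" for r
  proof -
    have gB: "\<bar>g r xs\<bar> \<le> r" for xs using r by (auto simp: g_def)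
    have "path_lip x m K 0 (g r)"
      unfolding g_def by (rule path_lip_compose[OF f]) auto
    then have mgf: "E t x m (\<lambda>xs. exp (\<theta> * g r xs)) \<le> exp ?a * exp (\<theta> * E t x m (g r))"
      using joint_law_bounds[where f = "g r" and B = r and A = 0 and m = m] t gB assms(4-6) by auto
    let ?c = "exp (\<theta> * (y + E t x m f))"
    \<comment> \<open>As \<open>r\<close> is at least \<open>\<bar>y + E t x m f\<bar>\<close>,
      truncation keeps values above the threshold \<open>y + E t x m f\<close> above it.\<close>
    have "?c \<le> exp (\<theta> * g r xs)" if "f xs - E t x m f \<ge> y" for xs
      using that r \<theta> by (auto simp: g_def intro!: mult_left_mono)
    then have "measure ?p {xs. f xs - E t x m f \<ge> y} \<le> measure ?p {xs \<in> space ?p. exp (\<theta> * g r xs) \<ge> ?c}"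
      by (intro measure_pmf.finite_measure_mono) auto
    also have "\<dots> \<le> E t x m (\<lambda>xs. exp (\<theta> * g r xs)) / ?c"
    proof (rule integral_Markov_inequality_measure[where A = "{}"])
      have "\<bar>exp (\<theta> * g r xs)\<bar> \<le> exp (\<theta> * r)" for xs
        using gB[of xs] \<theta> by (auto intro!: mult_left_mono)
      then show "integrable ?p (\<lambda>xs. exp (\<theta> * g r xs))" by (rule integrable_pmf_bounded)
    qed auto
    also have "\<dots> \<le> exp ?a * exp (\<theta> * E t x m (g r)) / ?c"
      by (intro divide_right_mono mgf) simp
    also have "\<dots> = exp (?a - \<theta> * (y + (E t x m f - E t x m (g r))))"
      by (simp add: algebra_simps flip: exp_add exp_diff)
    finally show ?thesis .
  qed
  then show "\<forall>\<^sub>F r in at_top. measure ?p {xs. f xs - E t x m f \<ge> y}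
      \<le> exp (?a - \<theta> * (y + (E t x m f - E t x m (g r))))"
    using eventually_ge_at_top by (rule eventually_mono[rotated])
qed simp

end

section \<open>Optimisation of the exponent and conclusion\<close>

text \<open>The chosen \<open>\<theta>\<close> minimises the left side: its derivative
  \<open>a * c * (exp (\<theta> * c) - 1) - y\<close> vanishes there. The minimum is minus
  \<open>a\<close> times Bennett's function at \<open>u = y / (a * c)\<close>.\<close>

lemma bennett_exponent:
  fixes a c y :: real
  assumes "a > 0" "c > 0" "y > 0"
  defines "\<theta> \<equiv> ln (1 + y / (a * c)) / c"
  shows "a * compensator (\<theta> * c) - \<theta> * y \<le> - (y / (2 * c)) * ln (1 + y / (a * c))"
proof -
  define u where "u = y / (a * c)"
  have u: "u > 0" "y = a * c * u" using assms by (auto simp: u_def)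
  have "a * compensator (\<theta> * c) - \<theta> * y = - a * ((1 + u) * ln (1 + u) - u)"
    using u assms(1,2) by (simp add: compensator_def \<theta>_def u_def[symmetric] field_simps)
  also have "\<dots> \<le> - a * (u / 2 * ln (1 + u))"
    using ln_one_plus_lower_bound[of u] u assms(1) by (intro mult_left_mono_neg) (auto simp: field_simps)
  also have "\<dots> = - (y / (2 * c)) * ln (1 + u)" using u assms(2) by simp
  finally show ?thesis by (simp add: u_def)
qed

theorem corollary4p12:
  fixes lam \<nu> T y :: real
    and n x :: nat
    and t :: "nat \<Rightarrow> real"
    and M :: "'a measure"
    and X :: "real \<Rightarrow> 'a \<Rightarrow> nat"
    and f :: "nat list \<Rightarrow> real"
  assumes "lam > 0" and "\<nu> > 0"
    and "mm1_process_from lam \<nu> x M X"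
    and "n \<ge> 1" and "t 0 = 0" and "\<forall>i<n. t i < t (Suc i)" and "t n = T"
    and "l1_lipschitz n f"
    and "y > 0"
  shows "measure M {\<omega> \<in> space M. f (sample X t n \<omega>) - (\<integral>\<omega>'. f (sample X t n \<omega>') \<partial>M) \<ge> y}
         \<le> (if lip_norm n f = 0 then 0
            else exp (- (y / (2 * real n * lip_norm n f))
                      * ln (1 + y / (T * real n * (lam + \<nu>) * lip_norm n f))))"
proof -
  obtain P where P: "transition_semigroup P" "has_generator P (mm1_generator lam \<nu>)"
    and chain: "markov_chain_from P x M X"
    using assms(3) by (auto simp: mm1_process_from_def)
  interpret mm1_semigroup lam \<nu> P
    using assms(1,2) P by unfold_locales
  let ?p = "measure_pmf (joint_law P t x n)" and ?K = "lip_norm n f"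
  have t: "t 0 = 0" "\<And>i. i < n \<Longrightarrow> t i < t (Suc i)" using assms by auto
  have meas [measurable]: "sample X t n \<in> measurable M (count_space UNIV)"
    and distr: "distr M (count_space UNIV) (sample X t n) = ?p"
    using distr_sample[where n = n, OF chain t] by auto
  have mean: "(\<integral>\<omega>'. f (sample X t n \<omega>') \<partial>M) = E t x n f"
    unfolding distr[symmetric] by (subst integral_distr) auto
  have "measure M {\<omega> \<in> space M. f (sample X t n \<omega>) - E t x n f \<ge> y}
      = measure ?p {xs. f xs - E t x n f \<ge> y}"
    unfolding distr[symmetric] by (subst measure_distr) (auto intro!: arg_cong[where f = "measure M"])
  then have tail_eq: "measure M {\<omega> \<in> space M. f (sample X t n \<omega>) - (\<integral>\<omega>'. f (sample X t n \<omega>') \<partial>M) \<ge> y}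
      = measure ?p {xs. f xs - E t x n f \<ge> y}"
    unfolding mean .
  have K: "?K \<ge> 0" by (rule lip_norm_nonneg) (use assms in auto)
  show ?thesis
  proof (cases "?K = 0")
    case True
    \<comment> \<open>With norm 0, \<open>f\<close> is constant on lists of length \<open>n\<close>
      and the event is null. The value 0 is the limit of the exponential bound as the norm tends to
      0.\<close>
    have const: "f xs = f (replicate n 0)" if "xs \<in> set_pmf (joint_law P t x n)" for xs
      using l1_lipschitz_bound[OF assms(8), of xs "replicate n 0"] length_joint_law[OF that] True by simp
    then have "E t x n f = E t x n (\<lambda>_. f (replicate n 0))"
      by (intro integral_cong_AE) (auto simp: AE_measure_pmf_iff)
    then have "measure ?p {xs. f xs - E t x n f \<ge> y} = 0"
      using const \<open>y > 0\<close> by (auto simp: measure_pmf_zero_iff)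
    then show ?thesis using True tail_eq by simp
  next
    case False
    \<comment> \<open>Here \<open>?a\<close> is the total jump rate accumulated up to
      \<open>T\<close>, and \<open>?c\<close> is the largest Lipschitz constant met in the backward
      integration.\<close>
    let ?a = "T * (lam + \<nu>)" and ?c = "real n * ?K"
    let ?th = "ln (1 + y / (?a * ?c)) / ?c"
    have "0 < T" using t(2)[of 0] sampling_times_mono[of n t 1 n] t assms(4,7) by auto
    then have pos: "?a > 0" "?c > 0" using False K assms by auto
    have "path_lip x n ?K 0 f"
      unfolding path_lip_def using l1_lipschitz_bound[OF assms(8)] by simp
    then have "measure ?p {xs. f xs - E t x n f \<ge> y}
        \<le> exp (t n * (lam + \<nu>) * compensator (?th * ?c) - ?th * y)"
      using pos \<open>y > 0\<close> by (intro joint_law_tail[where K = ?K] t K order_refl) auto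
    also have "\<dots> \<le> exp (- (y / (2 * ?c)) * ln (1 + y / (?a * ?c)))"
      using bennett_exponent[OF pos \<open>y > 0\<close>] assms(7) by simp
    also have "\<dots> = exp (- (y / (2 * real n * ?K)) * ln (1 + y / (T * real n * (lam + \<nu>) * ?K)))"
      by (simp add: algebra_simps)
    finally show ?thesis using False tail_eq by simp
  qed
qed

end
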